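(* Let $\phi(t)=\sum_{p\ge 0} g_p t^p$ be the formal power series in which $g_p$ is the number of Gated Ferrers diagrams of half-perimeter $p$ (as defined in the context). Then $\phi$ satisfies the quadratic equation $$\left[t^2 (1- 2 t)^4 (1-3t + t^2)\right] \phi^2 + \left[t^4 (1-3t+t^2) (1-2 t)^2 \right] \phi -t^{10}= 0 .$$
   Context: A Ferrers diagram (in this convention) is a finite collection of rows of unit square cells stacked vertically, numbered $1,\dots,n$ from bottom to top, all rows left-aligned (row $i$ occupies columns $1,\dots,m_i$), with $1\le m_1\le m_2\le\dots\le m_n$. Its half-perimeter is $m_n+n$ (half the length of its boundary). A Gated Ferrers diagram is a Ferrers diagram from which another Ferrers diagram (same conventions) is removed from the top, i.e. with an opening at the top. Precisely, it is given by integers $1\le j<n$, an integer $\ell\ge 1$, and integers $m_1,\dots,m_n$ and $g_{j+1},\dots,g_n$ such that: rows $1,\dots,j$ are full rows occupying columns $1,\dots,m_i$ with $m_1\le\dots\le m_j$; for $j<i\le n$, row $i$ occupies columns $1,\dots,\ell$ and columns $g_i+1,\dots,m_i$, the columns $\ell+1,\dots,g_i$ being empty (the gate), where $\ell<g_i<m_i$; and moreover $g_{j+1}<m_j$, and for $j<i<n$: $g_i\le g_{i+1}<m_i$; and $m_j\le m_{j+1}\le\dots\le m_n$. (Thus the removed cells form a left-aligned Ferrers shape whose bottom row lies directly above cells of row $j$ and whose top is open.) Its half-perimeter is half the length of the boundary of the union of its cells, which equals $m_n+n+(n-j)$. *)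

theory Defs
  imports "HOL-Computational_Algebra.Formal_Power_Series"
begin

text \<open>
  A unit cell is the pair (column, row) of its integer coordinates. Rows are numbered from
  bottom to top.
\<close>

type_synonym cell = "int \<times> int"

definition neighbours :: "cell \<Rightarrow> cell set" where
  "neighbours = (\<lambda>(c, r). {(c + 1, r), (c - 1, r), (c, r + 1), (c, r - 1)})"

text \<open>
  A unit segment lies on the boundary of the union of the cells of \<open>S\<close> iff it separates a cell
  of \<open>S\<close> from an adjacent cell outside \<open>S\<close>, and then it determines this pair of cells.
\<close>

definition boundary_edges :: "cell set \<Rightarrow> (cell \<times> cell) set" where
  "boundary_edges S = {(x, y). x \<in> S \<and> y \<in> neighbours x \<and> y \<notin> S}"

definition half_perimeter :: "cell set \<Rightarrow> real" where
  "half_perimeter S = real (card (boundary_edges S)) / 2"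

definition gated_ferrers_data ::
    "nat \<Rightarrow> nat \<Rightarrow> int \<Rightarrow> (nat \<Rightarrow> int) \<Rightarrow> (nat \<Rightarrow> int) \<Rightarrow> bool" where
  "gated_ferrers_data n j l m g \<longleftrightarrow>
     1 \<le> j \<and> j < n \<and> 1 \<le> l \<and>
     1 \<le> m 1 \<and> (\<forall>i. 1 \<le> i \<and> i < n \<longrightarrow> m i \<le> m (i + 1)) \<and>
     (\<forall>i. j < i \<and> i \<le> n \<longrightarrow> l < g i \<and> g i < m i) \<and>
     g (j + 1) < m j \<and>
     (\<forall>i. j < i \<and> i < n \<longrightarrow> g i \<le> g (i + 1) \<and> g (i + 1) < m i)"

definition gated_ferrers_cells ::
    "nat \<Rightarrow> nat \<Rightarrow> int \<Rightarrow> (nat \<Rightarrow> int) \<Rightarrow> (nat \<Rightarrow> int) \<Rightarrow> cell set" where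
  "gated_ferrers_cells n j l m g =
     {(c, int i) | c i. 1 \<le> i \<and> i \<le> j \<and> 1 \<le> c \<and> c \<le> m i} \<union>
     {(c, int i) | c i. j < i \<and> i \<le> n \<and> (1 \<le> c \<and> c \<le> l \<or> g i + 1 \<le> c \<and> c \<le> m i)}"

text \<open>
  A diagram is its set of cells, so that values of \<open>m\<close> and \<open>g\<close> at irrelevant indices play no role
  in the enumeration.
\<close>

definition gated_ferrers :: "cell set \<Rightarrow> bool" where
  "gated_ferrers S \<longleftrightarrow>
     (\<exists>n j l m g. gated_ferrers_data n j l m g \<and> S = gated_ferrers_cells n j l m g)"

definition gated_ferrers_count :: "nat \<Rightarrow> nat" where
  "gated_ferrers_count p = card {S. gated_ferrers S \<and> half_perimeter S = real p}"

definition gated_ferrers_gf :: "int fps" where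
  "gated_ferrers_gf = Abs_fps (\<lambda>p. int (gated_ferrers_count p))"

end

theory Submission
  imports Defs
begin

text \<open>
  Write \<open>d\<close> for the difference \<open>m - g\<close> in a gated row. Stacking one more row raises \<open>g\<close> by some
  \<open>u < d\<close> and \<open>m\<close> by some \<open>v\<close>, at a cost of \<open>v + 2\<close> in the half-perimeter. Hence the generating
  functions \<open>G d\<close> of the possible continuations satisfy
  \<open>t G (d + 2) - (1 + t - t^2) G (d + 1) + G d = 0\<close> with \<open>G 0 = 1\<close>. This recurrence has only one
  power series solution, namely \<open>G d = L^d\<close> with \<open>L = G 1\<close> and \<open>t L^2 - (1 + t - t^2) L + 1 = 0\<close>.
  The full rows below a row of length \<open>M\<close> contribute \<open>1 / (1 - t)^M\<close>. Summing the geometric series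
  over \<open>l\<close> and \<open>m j\<close> gives
  \<open>\<phi> = t^3 / (1 - 2 t) * (1 / (1 - t - t L) - 1 / (1 - 2 t))\<close>, and eliminating \<open>L\<close> yields the
  equation.
\<close>

unbundle fps_syntax

subsection \<open>Generating functions of weighted sets\<close>

definition weight_gf :: "'a set \<Rightarrow> ('a \<Rightarrow> nat) \<Rightarrow> int fps" where
  "weight_gf A w = Abs_fps (\<lambda>p. int (card {x \<in> A. w x = p}))"

text \<open>\<open>card\<close> is 0 on infinite sets, so generating functions add and multiply as
  expected only when every weight is attained finitely often.\<close>

definition finite_levels :: "'a set \<Rightarrow> ('a \<Rightarrow> nat) \<Rightarrow> bool" where
  "finite_levels A w \<longleftrightarrow> (\<forall>p. finite {x \<in> A. w x = p})"

lemma weight_gf_image: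
  assumes inj: "inj_on f A" and wt: "\<And>x. x \<in> A \<Longrightarrow> wB (f x) = k + wA x"
  shows "weight_gf (f ` A) wB = fps_X ^ k * weight_gf A wA"
proof (rule fps_ext)
  fix p
  show "weight_gf (f ` A) wB $ p = (fps_X ^ k * weight_gf A wA) $ p"
  proof (cases "p < k")
    case True
    then have "{x \<in> f ` A. wB x = p} = {}"
      using wt by auto
    with True show ?thesis
      by (simp only: weight_gf_def fps_nth_Abs_fps fps_X_power_mult_nth card.empty) simp
  next
    case False
    then have "{x \<in> f ` A. wB x = p} = f ` {x \<in> A. wA x = p - k}"
      using wt by auto
    moreover have "inj_on f {x \<in> A. wA x = p - k}"
      using inj by (rule inj_on_subset) auto
    ultimately have "card {x \<in> f ` A. wB x = p} = card {x \<in> A. wA x = p - k}"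
      by (simp add: card_image)
    with False show ?thesis
      by (simp add: weight_gf_def fps_X_power_mult_nth)
  qed
qed

lemma weight_gf_split:
  assumes fin: "finite_levels C w" and C: "C = A \<union> B" and "A \<inter> B = {}"
  shows "weight_gf C w = weight_gf A w + weight_gf B w"
proof (rule fps_ext)
  fix p
  have eq: "{x \<in> C. w x = p} = {x \<in> A. w x = p} \<union> {x \<in> B. w x = p}"
    using C by auto
  moreover have "finite {x \<in> C. w x = p}"
    using fin by (simp add: finite_levels_def)
  ultimately have "card {x \<in> C. w x = p} = card {x \<in> A. w x = p} + card {x \<in> B. w x = p}"
    using \<open>A \<inter> B = {}\<close> by (simp only: finite_Un, intro card_Un_disjoint) auto
  then show "weight_gf C w $ p = (weight_gf A w + weight_gf B w) $ p"
    by (simp add: weight_gf_def)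
qed

lemma weight_gf_empty [simp]: "weight_gf {} w = 0"
  by (rule fps_ext) (simp add: weight_gf_def)

lemma weight_gf_singleton: "weight_gf {x} w = fps_X ^ w x"
proof (rule fps_ext)
  fix p
  have "{y \<in> {x}. w y = p} = (if p = w x then {x} else {})"
    by auto
  then show "weight_gf {x} w $ p = (fps_X ^ w x) $ p"
    by (simp add: weight_gf_def)
qed

lemma finite_levels_subset: "finite_levels B w \<Longrightarrow> A \<subseteq> B \<Longrightarrow> finite_levels A w"
  unfolding finite_levels_def
proof
  fix p
  assume "\<forall>p. finite {x \<in> B. w x = p}" "A \<subseteq> B"
  then show "finite {x \<in> A. w x = p}"
    by (intro finite_subset[of "{x \<in> A. w x = p}" "{x \<in> B. w x = p}"]) auto
qed

lemma product_levels:
  fixes v :: "'a \<Rightarrow> nat" and w :: "'b \<Rightarrow> nat"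
  shows "{z \<in> A \<times> B. (case z of (x, y) \<Rightarrow> v x + w y) = p} =
     (\<Union>i\<in>{0..p}. {x \<in> A. v x = i} \<times> {y \<in> B. w y = p - i})"
  by (auto split: prod.splits)

lemma finite_levels_Times:
  assumes "finite_levels A v" "finite_levels B w"
  shows "finite_levels (A \<times> B) (\<lambda>(x, y). v x + w y)"
  using assms unfolding finite_levels_def product_levels
  by (intro allI finite_UN_I finite_cartesian_product) simp_all

lemma weight_gf_Times:
  assumes "finite_levels A v" "finite_levels B w"
  shows "weight_gf (A \<times> B) (\<lambda>(x, y). v x + w y) = weight_gf A v * weight_gf B w"
proof (rule fps_ext)
  fix p
  have "card {z \<in> A \<times> B. (case z of (x, y) \<Rightarrow> v x + w y) = p} =
      (\<Sum>i\<in>{0..p}. card ({x \<in> A. v x = i} \<times> {y \<in> B. w y = p - i}))"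
    unfolding product_levels
    using assms by (intro card_UN_disjoint) (auto simp: finite_levels_def)
  then show "weight_gf (A \<times> B) (\<lambda>(x, y). v x + w y) $ p = (weight_gf A v * weight_gf B w) $ p"
    by (simp add: weight_gf_def fps_mult_nth card_cartesian_product)
qed

text \<open>The generating function of \<open>tail_sum A e\<close> is the sum of \<open>t^v\<close> times that of \<open>A (e + v)\<close>.\<close>

definition tail_sum :: "(nat \<Rightarrow> 'a set) \<Rightarrow> nat \<Rightarrow> (nat \<times> 'a) set" where
  "tail_sum A e = {(v, x). x \<in> A (e + v)}"

definition tail_weight :: "('a \<Rightarrow> nat) \<Rightarrow> nat \<times> 'a \<Rightarrow> nat" where
  "tail_weight w = (\<lambda>(v, x). v + w x)"

text \<open>Weight \<open>p\<close> forces the offset \<open>v\<close> to be at most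
  \<open>p\<close>, so only finitely many of the sets contribute.\<close>

lemma finite_levels_tail_sum:
  assumes "\<And>e. finite_levels (A e) w"
  shows "finite_levels (tail_sum A e) (tail_weight w)"
  unfolding finite_levels_def
proof
  fix p
  have "{z \<in> tail_sum A e. tail_weight w z = p} \<subseteq> (SIGMA v:{..p}. {x \<in> A (e + v). w x = p - v})"
    by (auto simp: tail_sum_def tail_weight_def)
  moreover have "finite (SIGMA v:{..p}. {x \<in> A (e + v). w x = p - v})"
    using assms by (intro finite_SigmaI) (auto simp: finite_levels_def)
  ultimately show "finite {z \<in> tail_sum A e. tail_weight w z = p}"
    by (rule finite_subset)
qed

text \<open>The pairs with offset 0 form a copy of \<open>A e\<close>; lowering a positive offset by
  one yields the factor \<open>fps_X\<close>. This recurrence stands in for the infinite sum over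
  the offset.\<close>

lemma weight_gf_tail_sum:
  fixes e :: nat
  assumes fin: "\<And>e. finite_levels (A e) w"
  shows "weight_gf (tail_sum A e) (tail_weight w) =
    weight_gf (A e) w + fps_X * weight_gf (tail_sum A (Suc e)) (tail_weight w)"
proof -
  let ?Z = "Pair 0 ` A e" and ?S = "(\<lambda>(v, x). (Suc v, x)) ` tail_sum A (Suc e)"
  have split: "tail_sum A e = ?Z \<union> ?S"
  proof (intro equalityI subsetI)
    fix z assume z: "z \<in> tail_sum A e"
    obtain v x where vx: "z = (v, x)"
      by (cases z)
    show "z \<in> ?Z \<union> ?S"
    proof (cases v)
      case 0
      with z vx show ?thesis
        by (auto simp: tail_sum_def)
    next
      case (Suc v')
      with z vx have "(v', x) \<in> tail_sum A (Suc e)"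
        by (auto simp: tail_sum_def)
      then have "z \<in> ?S"
        unfolding vx Suc by (rule rev_image_eqI) simp
      then show ?thesis
        by blast
    qed
  qed (auto simp: tail_sum_def)
  have Z: "weight_gf ?Z (tail_weight w) = fps_X ^ 0 * weight_gf (A e) w"
    by (rule weight_gf_image) (auto simp: inj_on_def tail_weight_def)
  have S: "weight_gf ?S (tail_weight w) =
      fps_X ^ 1 * weight_gf (tail_sum A (Suc e)) (tail_weight w)"
    by (rule weight_gf_image) (auto simp: inj_on_def tail_weight_def)
  have "?Z \<inter> ?S = {}"
    by auto
  from weight_gf_split[OF finite_levels_tail_sum[OF fin] split this] show ?thesis
    by (rule trans) (simp add: Z S)
qed

text \<open>Coefficient \<open>p + 1\<close> depends only on \<open>G\<close> and on coefficient
  \<open>p\<close> at the next index, so the recurrence alone fixes every value. Closed forms of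
  infinite sums are verified this way.\<close>

lemma tail_recurrence_unique:
  fixes S T G :: "nat \<Rightarrow> int fps"
  assumes S: "\<And>e. S e = G e + fps_X * S (Suc e)" and T: "\<And>e. T e = G e + fps_X * T (Suc e)"
  shows "S e = T e"
proof (rule fps_ext)
  fix p
  show "S e $ p = T e $ p"
  proof (induction p arbitrary: e)
    case 0
    show ?case
      by (subst S, subst T) simp
  next
    case (Suc p)
    show ?case
      by (subst S, subst T) (simp add: Suc)
  qed
qed

text \<open>The coefficients are integers, so reciprocals enter the proof as witnesses of
  \<open>f * g = 1\<close>.\<close>

lemma fps_ex_inverse:
  fixes f :: "int fps"
  assumes "f $ 0 = 1"
  obtains g where "f * g = 1"
  using fps_right_inverse[of f 1] assms by auto

subsection \<open>Row increments\<close>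

text \<open>Decrements of row length from row \<open>j\<close> down to row 1.\<close>

definition lower_steps :: "nat \<Rightarrow> nat list set" where
  "lower_steps M = {us. sum_list us \<le> M}"

lemma finite_levels_lower_steps: "finite_levels (lower_steps M) length"
  unfolding finite_levels_def
proof
  fix p
  have "{us \<in> lower_steps M. length us = p} \<subseteq> {us. set us \<subseteq> {..M} \<and> length us = p}"
    using member_le_sum_list by (fastforce simp: lower_steps_def)
  then show "finite {us \<in> lower_steps M. length us = p}"
    by (rule finite_subset) (simp add: finite_lists_length_eq)
qed

lemma weight_gf_lower_steps_0:
  "weight_gf (lower_steps 0) length = 1 + fps_X * weight_gf (lower_steps 0) length"
proof -
  have split: "lower_steps 0 = {[]} \<union> Cons 0 ` lower_steps 0"
  proof (intro equalityI subsetI)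
    fix us assume "us \<in> lower_steps 0"
    then show "us \<in> {[]} \<union> Cons 0 ` lower_steps 0"
      by (cases us) (auto simp: lower_steps_def)
  qed (auto simp: lower_steps_def)
  have Z: "weight_gf (Cons 0 ` lower_steps 0) length = fps_X ^ 1 * weight_gf (lower_steps 0) length"
    by (rule weight_gf_image) auto
  have "{[]} \<inter> Cons 0 ` lower_steps 0 = {}"
    by auto
  from weight_gf_split[OF finite_levels_lower_steps split this] show ?thesis
    \<comment> \<open>The same generating function recurs on the right, so the equation is composed
      by transitivity; rewriting with it would loop.\<close>
    by (rule trans) (simp add: Z weight_gf_singleton)
qed

text \<open>A leading 0 is removed at the cost of one unit of length; a positive first entry is
  lowered by one at no cost, and the empty list stays fixed.\<close>

lemma weight_gf_lower_steps_Suc: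
  "weight_gf (lower_steps (Suc M)) length =
     weight_gf (lower_steps M) length + fps_X * weight_gf (lower_steps (Suc M)) length"
proof -
  define inc where "inc = (\<lambda>us. case us of [] \<Rightarrow> [] | u # us' \<Rightarrow> Suc u # us')"
  have split: "lower_steps (Suc M) = inc ` lower_steps M \<union> Cons 0 ` lower_steps (Suc M)"
  proof (intro equalityI subsetI)
    fix us assume us: "us \<in> lower_steps (Suc M)"
    consider "us = []" | us' where "us = 0 # us'" | u us' where "us = Suc u # us'"
      by (metis list.exhaust not0_implies_Suc)
    then show "us \<in> inc ` lower_steps M \<union> Cons 0 ` lower_steps (Suc M)"
    proof cases
      case 1
      then show ?thesis
        by (auto simp: inc_def lower_steps_def intro!: image_eqI[of _ _ "[]"])
    next
      case 2
      with us show ?thesis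
        by (auto simp: lower_steps_def)
    next
      case (3 u us')
      with us show ?thesis
        by (auto simp: inc_def lower_steps_def intro!: image_eqI[of _ _ "u # us'"])
    qed
  qed (auto simp: lower_steps_def inc_def split: list.splits)
  have I: "weight_gf (inc ` lower_steps M) length = fps_X ^ 0 * weight_gf (lower_steps M) length"
    by (rule weight_gf_image) (auto simp: inj_on_def inc_def split: list.splits)
  have Z: "weight_gf (Cons 0 ` lower_steps (Suc M)) length =
      fps_X ^ 1 * weight_gf (lower_steps (Suc M)) length"
    by (rule weight_gf_image) auto
  have "inc ` lower_steps M \<inter> Cons 0 ` lower_steps (Suc M) = {}"
    by (auto simp: inc_def split: list.splits)
  from weight_gf_split[OF finite_levels_lower_steps split this] show ?thesis
    by (rule trans) (simp add: I Z)
qed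

text \<open>Each unit of \<open>M\<close> contributes one factor \<open>y\<close>, and
  \<open>M = 0\<close> already contributes one. In the codes \<open>M\<close> is one less than the
  length of row \<open>j\<close>.\<close>

lemma weight_gf_lower_steps:
  assumes y: "(1 - fps_X) * y = 1"
  shows "weight_gf (lower_steps M) length = y ^ Suc M"
proof -
  have cancel: "W = y * V" if "(1 - fps_X) * W = V" for W V
  proof -
    have "y * ((1 - fps_X) * W) = (1 - fps_X) * y * W"
      by (simp only: ac_simps)
    then show ?thesis
      by (simp only: that y mult_1_left)
  qed
  show ?thesis
  proof (induction M)
    case 0
    have "(1 - fps_X) * weight_gf (lower_steps 0) length = 1"
      unfolding left_diff_distrib mult_1_left diff_eq_eq by (rule weight_gf_lower_steps_0)
    from cancel[OF this] show ?case
      by simp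
  next
    case (Suc M)
    have "(1 - fps_X) * weight_gf (lower_steps (Suc M)) length = y ^ Suc M"
      unfolding left_diff_distrib mult_1_left diff_eq_eq Suc[symmetric]
      by (rule weight_gf_lower_steps_Suc)
    from cancel[OF this] show ?case
      by simp
  qed
qed

text \<open>
  A pair \<open>(u, v)\<close> records the increments of \<open>g\<close> and of \<open>m\<close> when passing to the next row above,
  and \<open>d\<close> is the current value of \<open>m - g\<close>.
\<close>

primrec admissible :: "nat \<Rightarrow> (nat \<times> nat) list \<Rightarrow> bool" where
  "admissible d [] \<longleftrightarrow> True"
| "admissible d (s # ps) \<longleftrightarrow> fst s < d \<and> admissible (d - fst s + snd s) ps"

definition upper_steps :: "nat \<Rightarrow> (nat \<times> nat) list set" where
  "upper_steps d = {ps. admissible d ps}"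

text \<open>The condition \<open>j < n\<close> asks for at least one gated row.\<close>

definition upper_steps1 :: "nat \<Rightarrow> (nat \<times> nat) list set" where
  "upper_steps1 d = {ps. admissible d ps \<and> ps \<noteq> []}"

text \<open>A gated row counts once in \<open>n\<close> and once in \<open>n - j\<close>; the
  increments of \<open>m\<close> add up in the last row length, while those of \<open>g\<close> cost
  nothing.\<close>

definition upper_weight :: "(nat \<times> nat) list \<Rightarrow> nat" where
  "upper_weight ps = sum_list (map snd ps) + 2 * length ps"

text \<open>The width grows only through the increments of \<open>m\<close>. As
  \<open>upper_weight\<close> ignores the increments of \<open>g\<close>, finiteness of the levels
  rests on this bound.\<close>

lemma admissible_fst_less:
  "admissible d ps \<Longrightarrow> s \<in> set ps \<Longrightarrow> fst s < d + sum_list (map snd ps)"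
proof (induction ps arbitrary: d)
  case (Cons a ps)
  then show ?case
    using Cons.IH[of "d - fst a + snd a"] by auto
qed simp

lemma finite_levels_upper_steps: "finite_levels (upper_steps d) upper_weight"
  unfolding finite_levels_def
proof
  fix p
  have "{ps \<in> upper_steps d. upper_weight ps = p} \<subseteq>
      {ps. set ps \<subseteq> {..d + p} \<times> {..p} \<and> length ps \<le> p}"
  proof (intro subsetI CollectI conjI)
    fix ps s assume ps: "ps \<in> {ps \<in> upper_steps d. upper_weight ps = p}" and s: "s \<in> set ps"
    from s have "snd s \<le> sum_list (map snd ps)"
      by (force intro: member_le_sum_list)
    with ps s show "s \<in> {..d + p} \<times> {..p}"
      using admissible_fst_less[of d ps s]
      by (cases s) (auto simp: upper_steps_def upper_weight_def)
  qed (auto simp: upper_weight_def)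
  then show "finite {ps \<in> upper_steps d. upper_weight ps = p}"
    by (rule finite_subset) (simp add: finite_lists_length_le)
qed

lemma finite_levels_upper_steps1: "finite_levels (upper_steps1 d) upper_weight"
  using finite_levels_upper_steps
  by (rule finite_levels_subset) (auto simp: upper_steps_def upper_steps1_def)

lemma weight_gf_upper_steps:
  "weight_gf (upper_steps d) upper_weight = 1 + weight_gf (upper_steps1 d) upper_weight"
proof -
  have split: "upper_steps d = {[]} \<union> upper_steps1 d"
    by (auto simp: upper_steps_def upper_steps1_def)
  have "{[]} \<inter> upper_steps1 d = {}"
    by (auto simp: upper_steps1_def)
  from weight_gf_split[OF finite_levels_upper_steps split this] show ?thesis
    by (rule trans) (simp add: weight_gf_singleton upper_weight_def)
qed

lemma upper_steps1_0: "upper_steps1 0 = {}"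
proof -
  have "ps = []" if "admissible 0 ps" for ps
    using that by (cases ps) auto
  then show ?thesis
    by (auto simp: upper_steps1_def)
qed

text \<open>Split on the first increment \<open>u\<close> of \<open>g\<close>. If it is positive,
  lowering both \<open>u\<close> and the width by one preserves the weight and the next width. If it
  is 0, the row costs 2 and the sum over \<open>v\<close> remains.\<close>

lemma weight_gf_upper_steps1_Suc:
  "weight_gf (upper_steps1 (Suc d)) upper_weight = weight_gf (upper_steps1 d) upper_weight +
     fps_X ^ 2 * weight_gf (tail_sum upper_steps (Suc d)) (tail_weight upper_weight)"
proof -
  define inc :: "(nat \<times> nat) list \<Rightarrow> (nat \<times> nat) list"
    where "inc = (\<lambda>ps. (Suc (fst (hd ps)), snd (hd ps)) # tl ps)"
  define new :: "nat \<times> (nat \<times> nat) list \<Rightarrow> (nat \<times> nat) list"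
    where "new = (\<lambda>(v, ps). (0, v) # ps)"
  let ?I = "inc ` upper_steps1 d" and ?N = "new ` tail_sum upper_steps (Suc d)"
  have split: "upper_steps1 (Suc d) = ?I \<union> ?N"
  proof (intro equalityI subsetI)
    fix ps assume ps: "ps \<in> upper_steps1 (Suc d)"
    then obtain u v ps' where eq: "ps = (u, v) # ps'"
      by (cases ps) (auto simp: upper_steps1_def)
    show "ps \<in> ?I \<union> ?N"
    proof (cases u)
      case 0
      with ps eq have "(v, ps') \<in> tail_sum upper_steps (Suc d)" "ps = new (v, ps')"
        by (auto simp: tail_sum_def upper_steps1_def upper_steps_def new_def)
      then show ?thesis
        by blast
    next
      case (Suc u')
      with ps eq have "(u', v) # ps' \<in> upper_steps1 d" "ps = inc ((u', v) # ps')"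
        by (auto simp: upper_steps1_def inc_def)
      then show ?thesis
        by blast
    qed
  next
    fix ps assume "ps \<in> ?I \<union> ?N"
    then show "ps \<in> upper_steps1 (Suc d)"
    proof
      assume "ps \<in> ?I"
      then obtain qs where "qs \<in> upper_steps1 d" "ps = inc qs"
        by blast
      then show ?thesis
        by (cases qs) (auto simp: upper_steps1_def inc_def)
    qed (auto simp: upper_steps1_def upper_steps_def tail_sum_def new_def)
  qed
  have I: "weight_gf ?I upper_weight = fps_X ^ 0 * weight_gf (upper_steps1 d) upper_weight"
  proof (rule weight_gf_image)
    show "inj_on inc (upper_steps1 d)"
      by (auto simp: inj_on_def inc_def upper_steps1_def)
        (metis list.collapse prod.collapse)
    fix ps assume "ps \<in> upper_steps1 d"
    then show "upper_weight (inc ps) = 0 + upper_weight ps"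
      by (cases ps) (auto simp: upper_steps1_def inc_def upper_weight_def)
  qed
  have N: "weight_gf ?N upper_weight =
      fps_X ^ 2 * weight_gf (tail_sum upper_steps (Suc d)) (tail_weight upper_weight)"
    by (rule weight_gf_image)
      (auto simp: inj_on_def new_def tail_weight_def upper_weight_def)
  have "?I \<inter> ?N = {}"
    by (auto simp: inc_def new_def)
  from weight_gf_split[OF finite_levels_upper_steps1 split this] show ?thesis
    by (rule trans) (simp add: I N)
qed

lemma upper_recurrence:
  fixes G :: "nat \<Rightarrow> int fps"
  defines "G \<equiv> \<lambda>d. weight_gf (upper_steps d) upper_weight"
  shows "G (Suc d) = G d + fps_X * (G (Suc (Suc d)) - G (Suc d) + fps_X * G (Suc d))"
proof -
  define S where "S = (\<lambda>d. weight_gf (tail_sum upper_steps d) (tail_weight upper_weight))"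
  have S: "S d = G d + fps_X * S (Suc d)" for d
    unfolding S_def G_def by (rule weight_gf_tail_sum) (rule finite_levels_upper_steps)
  have G: "G (Suc d) = G d + fps_X ^ 2 * S (Suc d)" for d
    unfolding S_def G_def weight_gf_upper_steps by (simp add: weight_gf_upper_steps1_Suc)
  show ?thesis
    \<comment> \<open>Two consecutive differences of \<open>G\<close> give \<open>fps_X ^ 2\<close>
      times two consecutive values of \<open>S\<close>; the recurrence of \<open>S\<close> links
      them and eliminates \<open>S\<close>.\<close>
    using S[of "Suc d"] G[of d] G[of "Suc d"] by algebra
qed

text \<open>The value at \<open>d + 2\<close> occurs only with a factor \<open>fps_X\<close>, so
  coefficient \<open>p\<close> needs it only below \<open>p\<close>. One initial value therefore
  suffices, by induction on \<open>p\<close> and then on \<open>d\<close>.\<close>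

lemma upper_recurrence_unique:
  fixes G H :: "nat \<Rightarrow> int fps"
  assumes G: "\<And>d. G (Suc d) = G d + fps_X * (G (Suc (Suc d)) - G (Suc d) + fps_X * G (Suc d))"
    and H: "\<And>d. H (Suc d) = H d + fps_X * (H (Suc (Suc d)) - H (Suc d) + fps_X * H (Suc d))"
    and "G 0 = H 0"
  shows "G d = H d"
proof -
  have "\<forall>d. G d $ p = H d $ p" for p
  proof (induction p rule: less_induct)
    case (less p)
    show ?case
    proof
      fix d
      show "G d $ p = H d $ p"
      proof (induction d)
        case (Suc d)
        show ?case
          by (subst G, subst H) (auto simp: Suc less)
      qed (simp add: assms)
    qed
  qed
  then show ?thesis
    by (auto intro: fps_ext)
qed

text \<open>
  A power series solution of the recurrence is determined by its value at 0, so it is geometric.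
\<close>

lemma weight_gf_upper_steps_power:
  "weight_gf (upper_steps d) upper_weight = weight_gf (upper_steps 1) upper_weight ^ d"
proof -
  define G where "G = (\<lambda>d. weight_gf (upper_steps d) upper_weight)"
  have G0: "G 0 = 1"
    by (simp add: G_def weight_gf_upper_steps upper_steps1_0)
  have rec: "G (Suc d) = G d + fps_X * (G (Suc (Suc d)) - G (Suc d) + fps_X * G (Suc d))" for d
    unfolding G_def by (rule upper_recurrence)
  have step: "G (Suc d) = G 1 * G d" for d
  \<comment> \<open>The recurrence is linear and invariant under shifts, so both the shifted
    sequence and the multiple of \<open>G\<close> solve it; they agree at 0 because
    \<open>G 0 = 1\<close>.\<close>
  proof (rule upper_recurrence_unique[where G = "\<lambda>d. G (Suc d)" and H = "\<lambda>d. G 1 * G d"])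
    fix d
    show "G 1 * G (Suc d) = G 1 * G d +
        fps_X * (G 1 * G (Suc (Suc d)) - G 1 * G (Suc d) + fps_X * (G 1 * G (Suc d)))"
      using rec[of d] by algebra
  qed (rule rec, simp add: G0)
  have "G d = G 1 ^ d"
  proof (induction d)
    case (Suc d)
    show ?case
      by (simp only: power_Suc step[of d] Suc)
  qed (simp add: G0)
  then show ?thesis
    by (simp add: G_def)
qed

text \<open>This is the recurrence at \<open>d = 0\<close>, whose three values are 1,
  \<open>L\<close> and \<open>L ^ 2\<close>.\<close>

lemma weight_gf_upper_steps_quadratic:
  fixes L :: "int fps"
  defines "L \<equiv> weight_gf (upper_steps 1) upper_weight"
  shows "fps_X * L ^ 2 - (1 + fps_X - fps_X ^ 2) * L + 1 = 0"
proof -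
  have power: "weight_gf (upper_steps d) upper_weight = L ^ d" for d
    unfolding L_def by (rule weight_gf_upper_steps_power)
  have "L = 1 + fps_X * (L * L - L + fps_X * L)"
    using upper_recurrence[of 0] unfolding power by (simp only: power_Suc power_0 mult_1_right)
  moreover have "fps_X * L ^ 2 - (1 + fps_X - fps_X ^ 2) * L + 1 =
      1 + fps_X * (L * L - L + fps_X * L) - L"
    by (simp add: algebra_simps power2_eq_square)
  ultimately show ?thesis
    by (simp only: right_minus_eq)
qed

text \<open>
  A code \<open>(d, e, us, ps)\<close> stands for the diagram with \<open>l = e + 1\<close> and \<open>m j = l + 1 + d\<close>; the gate
  starts from the fictitious value \<open>g j = l + 1\<close>.
\<close>

definition codes :: "(nat \<times> nat \<times> nat list \<times> (nat \<times> nat) list) set" where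
  "codes = tail_sum (\<lambda>d. tail_sum (\<lambda>M. lower_steps M \<times> upper_steps1 d) (d + 1)) 0"

text \<open>The half-perimeter less 3: of this constant, 2 comes from \<open>m j = d + e + 2\<close>
  and 1 from \<open>j = length us + 1\<close>.\<close>

definition code_weight :: "nat \<times> nat \<times> nat list \<times> (nat \<times> nat) list \<Rightarrow> nat" where
  "code_weight = tail_weight (tail_weight (\<lambda>(us, ps). length us + upper_weight ps))"

text \<open>Two nested geometric sums, first over \<open>e\<close> and then over \<open>d\<close>.
  Excluding the empty list turns \<open>L ^ d\<close> into \<open>L ^ d - 1\<close>, whence the
  difference \<open>x - z\<close>.\<close>

lemma weight_gf_codes:
  assumes y: "(1 - fps_X) * y = 1" and z: "(1 - fps_X * y) * z = 1"
    and x: "(1 - fps_X * (y * L)) * x = 1"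
    and L: "L = weight_gf (upper_steps 1) upper_weight"
  shows "weight_gf codes code_weight = y ^ 2 * z * (x - z)"
proof -
  let ?w = "\<lambda>(us, ps). length us + upper_weight ps"
  define K where "K = (\<lambda>d. tail_sum (\<lambda>M. lower_steps M \<times> upper_steps1 d))"
  have fin: "finite_levels (lower_steps M \<times> upper_steps1 d) ?w" for M d
    by (intro finite_levels_Times finite_levels_lower_steps finite_levels_upper_steps1)
  have prod: "weight_gf (lower_steps M \<times> upper_steps1 d) ?w = y ^ Suc M * (L ^ d - 1)" for M d
    using weight_gf_upper_steps[of d] weight_gf_upper_steps_power[of d]
    by (simp add: weight_gf_Times finite_levels_lower_steps finite_levels_upper_steps1
        weight_gf_lower_steps[OF y] L del: power_Suc)
  have gfK: "weight_gf (K d e) (tail_weight ?w) = y ^ Suc e * (L ^ d - 1) * z" for d e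
  proof (rule tail_recurrence_unique[where G = "\<lambda>e. y ^ Suc e * (L ^ d - 1)" and
        S = "\<lambda>e. weight_gf (K d e) (tail_weight ?w)"])
    fix e
    show "weight_gf (K d e) (tail_weight ?w) =
        y ^ Suc e * (L ^ d - 1) + fps_X * weight_gf (K d (Suc e)) (tail_weight ?w)"
      unfolding K_def by (subst weight_gf_tail_sum[OF fin]) (simp only: prod)
    have "y ^ Suc e * (L ^ d - 1) * ((1 - fps_X * y) * z) = y ^ Suc e * (L ^ d - 1)"
      by (simp add: z)
    then show "y ^ Suc e * (L ^ d - 1) * z =
        y ^ Suc e * (L ^ d - 1) + fps_X * (y ^ Suc (Suc e) * (L ^ d - 1) * z)"
      by (simp add: algebra_simps)
  qed
  have finK: "finite_levels (K d (d + 1)) (tail_weight ?w)" for d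
    unfolding K_def using fin by (rule finite_levels_tail_sum)
  \<comment> \<open>The recurrence shifts the starting index, so the closed form is needed for all
    \<open>e\<close>, although only \<open>e = 0\<close> is wanted.\<close>
  have "weight_gf (tail_sum (\<lambda>d. K d (d + 1)) e) (tail_weight (tail_weight ?w)) =
      y ^ 2 * z * ((y * L) ^ e * x - y ^ e * z)" for e
  proof (rule tail_recurrence_unique[where G = "\<lambda>d. y ^ Suc (d + 1) * (L ^ d - 1) * z" and
        S = "\<lambda>e. weight_gf (tail_sum (\<lambda>d. K d (d + 1)) e) (tail_weight (tail_weight ?w))"])
    fix e
    show "weight_gf (tail_sum (\<lambda>d. K d (d + 1)) e) (tail_weight (tail_weight ?w)) =
        y ^ Suc (e + 1) * (L ^ e - 1) * z +
        fps_X * weight_gf (tail_sum (\<lambda>d. K d (d + 1)) (Suc e)) (tail_weight (tail_weight ?w))"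
      by (subst weight_gf_tail_sum[OF finK]) (simp only: gfK)
    have "y ^ 2 * z * ((y * L) ^ e * ((1 - fps_X * (y * L)) * x) - y ^ e * ((1 - fps_X * y) * z)) =
        y ^ Suc (e + 1) * (L ^ e - 1) * z"
      by (simp only: x z) (simp add: algebra_simps power2_eq_square power_mult_distrib)
    then show "y ^ 2 * z * ((y * L) ^ e * x - y ^ e * z) = y ^ Suc (e + 1) * (L ^ e - 1) * z +
        fps_X * (y ^ 2 * z * ((y * L) ^ Suc e * x - y ^ Suc e * z))"
      by (simp add: algebra_simps)
  qed
  from this[of 0] show ?thesis
    by (simp add: codes_def code_weight_def K_def)
qed

lemma quadratic_elimination:
  fixes t y z x L \<psi> :: "'a :: idom"
  assumes y: "(1 - t) * y = 1" and z: "(1 - t * y) * z = 1" and x: "(1 - t * (y * L)) * x = 1"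
    and quad: "t * L ^ 2 - (1 + t - t ^ 2) * L + 1 = 0"
    and psi: "\<psi> = t ^ 3 * (y ^ 2 * z * (x - z))"
  shows "(t^2 * (1 - 2 * t)^4 * (1 - 3 * t + t^2)) * \<psi>^2
         + (t^4 * (1 - 3 * t + t^2) * (1 - 2 * t)^2) * \<psi> - t^10 = 0"
proof -
  \<comment> \<open>\<open>A\<close> and \<open>B\<close> are the polynomial factors of the target;
    \<open>B\<close> and \<open>C\<close> will turn out to be the reciprocals of
    \<open>y * z\<close> and \<open>D\<close>.\<close>
  define A where "A = 1 - 3 * t + t ^ 2"
  define B where "B = 1 - 2 * t"
  define C where "C = 1 - t - t * L"
  define D where "D = y * x"
  have "B * (y * z) = ((1 - t) * y - t * y) * z"
    unfolding B_def by (simp add: algebra_simps)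
  then have zB: "B * (y * z) = 1"
    using z by (simp add: y)
  have "C * D = ((1 - t) * y - t * (y * L)) * x"
    unfolding C_def D_def by (simp add: algebra_simps)
  then have xC: "C * D = 1"
    using x by (simp add: y)
  have "B ^ 2 * \<psi> = t ^ 3 * (B * (B * (y * z)) * D - (B * (y * z)) ^ 2)"
    unfolding psi D_def by (simp add: algebra_simps power2_eq_square)
  also have "\<dots> = t ^ 3 * (B * D - C * D)"
    by (simp only: zB xC) simp
  also have "\<dots> = t ^ 4 * (L - 1) * D"
    unfolding B_def C_def by algebra
  finally have R: "B ^ 2 * \<psi> = t ^ 4 * (L - 1) * D" .
  \<comment> \<open>A polynomial identity in \<open>t\<close> and \<open>L\<close>: the relation to
    be proved, with denominators cleared, is a multiple of the quadratic for
    \<open>L\<close>.\<close>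
  have "t ^ 2 * A * (L - 1) ^ 2 + A * (L - 1) * C - t ^ 2 * C ^ 2 =
      - (B ^ 2) * (t * L ^ 2 - (1 + t - t ^ 2) * L + 1)"
    unfolding A_def B_def C_def by algebra
  then have key: "t ^ 2 * A * (L - 1) ^ 2 + A * (L - 1) * C = t ^ 2 * C ^ 2"
    by (simp add: quad)
  \<comment> \<open>The factor \<open>C * D = 1\<close> makes both terms of degree 2 in
    \<open>D\<close>, once \<open>B ^ 2 * \<psi>\<close> is replaced by means of
    \<open>R\<close>.\<close>
  have "t ^ 2 * B ^ 4 * A * \<psi> ^ 2 + t ^ 4 * A * B ^ 2 * \<psi> =
      t ^ 2 * A * (B ^ 2 * \<psi>) ^ 2 + t ^ 4 * A * (B ^ 2 * \<psi>) * (C * D)"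
    by (simp only: xC) algebra
  also have "\<dots> = t ^ 8 * D ^ 2 * (t ^ 2 * A * (L - 1) ^ 2 + A * (L - 1) * C)"
    unfolding R by algebra
  also have "\<dots> = t ^ 10 * (C * D) ^ 2"
    unfolding key by algebra
  finally show ?thesis
    by (simp add: xC A_def B_def)
qed

lemma codes_quadratic:
  fixes t \<psi> :: "int fps"
  defines "t \<equiv> fps_X" and "\<psi> \<equiv> t ^ 3 * weight_gf codes code_weight"
  shows "(t^2 * (1 - 2 * t)^4 * (1 - 3 * t + t^2)) * \<psi>^2
         + (t^4 * (1 - 3 * t + t^2) * (1 - 2 * t)^2) * \<psi> - t^10 = 0"
proof -
  define L where "L = weight_gf (upper_steps 1) upper_weight"
  obtain y where y: "(1 - t) * y = 1"
    unfolding t_def by (rule fps_ex_inverse[of "1 - fps_X"]) auto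
  obtain z where z: "(1 - t * y) * z = 1"
    unfolding t_def by (rule fps_ex_inverse[of "1 - fps_X * y"]) auto
  obtain x where x: "(1 - t * (y * L)) * x = 1"
    unfolding t_def by (rule fps_ex_inverse[of "1 - fps_X * (y * L)"]) auto
  have "\<psi> = t ^ 3 * (y ^ 2 * z * (x - z))"
    unfolding \<psi>_def
    by (simp add: weight_gf_codes[OF y[unfolded t_def] z[unfolded t_def] x[unfolded t_def] L_def])
  moreover have "t * L ^ 2 - (1 + t - t ^ 2) * L + 1 = 0"
    unfolding t_def L_def by (rule weight_gf_upper_steps_quadratic)
  ultimately show ?thesis
    using quadratic_elimination[OF y z x] by blast
qed

subsection \<open>The half-perimeter\<close>

text \<open>A convex column has exactly one lowest and one highest cell, so \<open>fst\<close> maps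
  the ends of either kind bijectively to the columns.\<close>

lemma card_column_ends:
  fixes S :: "cell set"
  assumes fin: "finite S"
    and convex: "\<And>c a b k. (c, a) \<in> S \<Longrightarrow> (c, b) \<in> S \<Longrightarrow> a \<le> k \<Longrightarrow> k \<le> b \<Longrightarrow> (c, k) \<in> S"
  shows "card {x \<in> S. (fst x, snd x - 1) \<notin> S} = card (fst ` S)"
    and "card {x \<in> S. (fst x, snd x + 1) \<notin> S} = card (fst ` S)"
proof -
  let ?col = "\<lambda>c. {r. (c, r) \<in> S}"
  have col: "finite (?col c)" for c
    using fin by (rule finite_subset[rotated, OF finite_imageI[of S snd]]) force
  have inj: "inj_on fst {x \<in> S. (fst x, snd x - 1) \<notin> S}"
  proof (rule inj_onI, rule ccontr)
    fix x y
    assume xy: "x \<in> {x \<in> S. (fst x, snd x - 1) \<notin> S}" "y \<in> {x \<in> S. (fst x, snd x - 1) \<notin> S}"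
      "fst x = fst y" "x \<noteq> y"
    then have "snd x < snd y \<or> snd y < snd x"
      by (metis linorder_neqE prod_eqI)
    then show False
      using xy convex[of "fst x" "snd x" "snd y" "snd y - 1"]
        convex[of "fst x" "snd y" "snd x" "snd x - 1"]
      by (auto simp: prod_eq_iff) (metis prod.collapse)+
  qed
  have img: "fst ` {x \<in> S. (fst x, snd x - 1) \<notin> S} = fst ` S"
  proof (intro equalityI subsetI)
    fix c assume "c \<in> fst ` S"
    then have ne: "?col c \<noteq> {}"
      by force
    have "Min (?col c) \<in> ?col c"
      using col ne by (rule Min_in)
    moreover have "(c, Min (?col c) - 1) \<notin> S"
      using Min_le[OF col, of "Min (?col c) - 1" c] by auto
    ultimately show "c \<in> fst ` {x \<in> S. (fst x, snd x - 1) \<notin> S}"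
      by (intro image_eqI[of _ _ "(c, Min (?col c))"]) auto
  qed auto
  show "card {x \<in> S. (fst x, snd x - 1) \<notin> S} = card (fst ` S)"
    using card_image[OF inj] unfolding img by (rule sym)
  have inj: "inj_on fst {x \<in> S. (fst x, snd x + 1) \<notin> S}"
  proof (rule inj_onI, rule ccontr)
    fix x y
    assume xy: "x \<in> {x \<in> S. (fst x, snd x + 1) \<notin> S}" "y \<in> {x \<in> S. (fst x, snd x + 1) \<notin> S}"
      "fst x = fst y" "x \<noteq> y"
    then have "snd x < snd y \<or> snd y < snd x"
      by (metis linorder_neqE prod_eqI)
    then show False
      using xy convex[of "fst x" "snd x" "snd y" "snd x + 1"]
        convex[of "fst x" "snd y" "snd x" "snd y + 1"]
      by (auto simp: prod_eq_iff) (metis prod.collapse)+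
  qed
  have img: "fst ` {x \<in> S. (fst x, snd x + 1) \<notin> S} = fst ` S"
  proof (intro equalityI subsetI)
    fix c assume "c \<in> fst ` S"
    then have ne: "?col c \<noteq> {}"
      by force
    have "Max (?col c) \<in> ?col c"
      using col ne by (rule Max_in)
    moreover have "(c, Max (?col c) + 1) \<notin> S"
      using Max_ge[OF col, of "Max (?col c) + 1" c] by auto
    ultimately show "c \<in> fst ` {x \<in> S. (fst x, snd x + 1) \<notin> S}"
      by (intro image_eqI[of _ _ "(c, Max (?col c))"]) auto
  qed auto
  show "card {x \<in> S. (fst x, snd x + 1) \<notin> S} = card (fst ` S)"
    using card_image[OF inj] unfolding img by (rule sym)
qed

text \<open>Edges are sorted by direction; the four neighbours of a cell are distinct, so the four
  classes are disjoint.\<close>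

lemma card_boundary_edges:
  fixes S :: "cell set"
  assumes fin: "finite S"
  shows "card (boundary_edges S) =
    card {x \<in> S. (fst x + 1, snd x) \<notin> S} + card {x \<in> S. (fst x - 1, snd x) \<notin> S} +
    card {x \<in> S. (fst x, snd x + 1) \<notin> S} + card {x \<in> S. (fst x, snd x - 1) \<notin> S}"
proof -
  define edges where "edges = (\<lambda>f :: cell \<Rightarrow> cell. (\<lambda>x. (x, f x)) ` {x \<in> S. f x \<notin> S})"
  have card_edges: "card (edges f) = card {x \<in> S. f x \<notin> S}" for f
    unfolding edges_def by (rule card_image) (auto simp: inj_on_def)
  have fin_edges: "finite (edges f)" for f
    unfolding edges_def using fin by auto
  have disj: "edges f \<inter> edges h = {}" if "\<And>x. f x \<noteq> h x" for f h
    using that unfolding edges_def by blast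
  have eq: "boundary_edges S = edges (\<lambda>x. (fst x + 1, snd x)) \<union> edges (\<lambda>x. (fst x - 1, snd x)) \<union>
      edges (\<lambda>x. (fst x, snd x + 1)) \<union> edges (\<lambda>x. (fst x, snd x - 1))"
    by (auto simp: boundary_edges_def neighbours_def edges_def image_iff)
  show ?thesis
    unfolding eq card_edges[symmetric] by (simp add: card_Un_disjoint fin_edges Int_Un_distrib2 disj)
qed

section \<open>Boundary of a single gated diagram\<close>

locale gated_diagram =
  fixes n j :: nat and l :: int and m g :: "nat \<Rightarrow> int"
  assumes data: "gated_ferrers_data n j l m g"
begin

abbreviation "cells \<equiv> gated_ferrers_cells n j l m g"

lemma j_bounds: "1 \<le> j" "j < n" and l_pos: "1 \<le> l"
  using data by (auto simp: gated_ferrers_data_def)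

lemma gate_bounds: "j < i \<Longrightarrow> i \<le> n \<Longrightarrow> l < g i" "j < i \<Longrightarrow> i \<le> n \<Longrightarrow> g i < m i"
  using data by (auto simp: gated_ferrers_data_def)

lemma gate_less_below: "j \<le> i \<Longrightarrow> i < n \<Longrightarrow> g (Suc i) < m i"
  using data by (cases "i = j") (auto simp: gated_ferrers_data_def)

lemma row_mono: "i \<le> k \<Longrightarrow> 1 \<le> i \<Longrightarrow> k \<le> n \<Longrightarrow> m i \<le> m k"
proof (induction k rule: dec_induct)
  case (step k)
  then have "m k \<le> m (Suc k)"
    using data by (auto simp: gated_ferrers_data_def)
  with step show ?case
    by simp
qed simp

lemma gate_mono: "i \<le> k \<Longrightarrow> j < i \<Longrightarrow> k \<le> n \<Longrightarrow> g i \<le> g k"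
proof (induction k rule: dec_induct)
  case (step k)
  then have "g k \<le> g (Suc k)"
    using data by (auto simp: gated_ferrers_data_def)
  with step show ?case
    by simp
qed simp

lemma row_pos: "1 \<le> i \<Longrightarrow> i \<le> n \<Longrightarrow> 1 \<le> m i"
  using row_mono[of 1 i] data by (auto simp: gated_ferrers_data_def)

lemma mem_cells:
  "(c, int i) \<in> cells \<longleftrightarrow> 1 \<le> i \<and> i \<le> n \<and> 1 \<le> c \<and> c \<le> m i \<and> (j < i \<longrightarrow> c \<le> l \<or> g i < c)"
proof (cases "j < i \<and> i \<le> n")
  case True
  then show ?thesis
    using gate_bounds[of i] l_pos by (auto simp: gated_ferrers_cells_def)
next
  case False
  then show ?thesis
    using j_bounds by (auto simp: gated_ferrers_cells_def)
qed

lemma cellE: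
  assumes "x \<in> cells"
  obtains c i where "x = (c, int i)" "1 \<le> i" "i \<le> n"
  using assms j_bounds by (auto simp: gated_ferrers_cells_def)

lemma finite_cells: "finite cells"
proof (rule finite_subset)
  show "cells \<subseteq> {1..m n} \<times> int ` {1..n}"
  proof
    fix x assume x: "x \<in> cells"
    then obtain c i where ci: "x = (c, int i)" "1 \<le> i" "i \<le> n"
      by (rule cellE)
    then show "x \<in> {1..m n} \<times> int ` {1..n}"
      using x row_mono[of i n] by (auto simp: mem_cells)
  qed
qed simp

text \<open>The right border is inherited from the lower row since \<open>m\<close> increases; the
  gate is avoided because it is avoided in the upper row and \<open>g\<close> increases.\<close>

lemma column_convex:
  assumes "(c, a) \<in> cells" "(c, b) \<in> cells" "a \<le> k" "k \<le> b"
  shows "(c, k) \<in> cells"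
proof -
  obtain a' b' where ab: "a = int a'" "b = int b'"
    using assms(1,2) by (metis cellE prod.inject)
  with assms have "k = int (nat k)"
    by simp
  then obtain k' where k: "k = int k'"
    by blast
  show ?thesis
    using assms row_mono[of a' k'] gate_mono[of k' b']
    unfolding ab k mem_cells by auto
qed

text \<open>If column \<open>c\<close> meets row \<open>k + 1\<close> inside the gate, then
  \<open>c \<le> g (k + 1) < m k\<close>, and the search descends to row \<open>k\<close>, at the
  latest to the full row \<open>j\<close>.\<close>

lemma column_nonempty: "j \<le> k \<Longrightarrow> k \<le> n \<Longrightarrow> l < c \<Longrightarrow> c \<le> m k \<Longrightarrow> \<exists>i. (c, int i) \<in> cells"
proof (induction k rule: dec_induct)
  case base
  then have "(c, int j) \<in> cells"
    using j_bounds l_pos by (auto simp: mem_cells)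
  then show ?case ..
next
  case (step k)
  show ?case
  proof (cases "g (Suc k) < c")
    case True
    with step have "(c, int (Suc k)) \<in> cells"
      using l_pos unfolding mem_cells by auto
    then show ?thesis ..
  next
    case False
    with step show ?thesis
      using gate_less_below[of k] by auto
  qed
qed

lemma columns: "fst ` cells = {1..m n}"
proof (intro equalityI subsetI)
  fix c assume "c \<in> fst ` cells"
  then obtain r where r: "(c, r) \<in> cells"
    by auto
  then obtain i where "r = int i"
    by (auto elim: cellE)
  with r have "(c, int i) \<in> cells"
    by simp
  then show "c \<in> {1..m n}"
    using row_mono[of i n] by (auto simp: mem_cells)
next
  fix c assume c: "c \<in> {1..m n}"
  show "c \<in> fst ` cells"
  proof (cases "c \<le> l")
    case True
    with c have "(c, int n) \<in> cells"
      using j_bounds by (auto simp: mem_cells)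
    then show ?thesis
      by force
  next
    case False
    with c obtain i where "(c, int i) \<in> cells"
      using column_nonempty[of n c] j_bounds by auto
    then show ?thesis
      by force
  qed
qed

lemma right_ends:
  "{x \<in> cells. (fst x + 1, snd x) \<notin> cells} =
     (\<lambda>i. (m i, int i)) ` {1..n} \<union> (\<lambda>i. (l, int i)) ` {j<..n}" (is "?L = ?R")
proof (intro equalityI subsetI)
  fix x assume x: "x \<in> ?L"
  then obtain c i where ci: "x = (c, int i)" "1 \<le> i" "i \<le> n"
    by (auto elim: cellE)
  with x have "c = m i \<or> j < i \<and> c = l"
    by (auto simp: mem_cells)
  with ci show "x \<in> ?R"
    by auto
next
  fix x assume "x \<in> ?R"
  then show "x \<in> ?L"
  proof (elim UnE imageE)
    fix i assume "x = (m i, int i)" "i \<in> {1..n}"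
    then show ?thesis
      using gate_bounds[of i] row_pos[of i] l_pos by (auto simp: mem_cells)
  next
    fix i assume "x = (l, int i)" "i \<in> {j<..n}"
    then show ?thesis
      using gate_bounds[of i] l_pos by (auto simp: mem_cells)
  qed
qed

lemma left_ends:
  "{x \<in> cells. (fst x - 1, snd x) \<notin> cells} =
     (\<lambda>i. (1, int i)) ` {1..n} \<union> (\<lambda>i. (g i + 1, int i)) ` {j<..n}" (is "?L = ?R")
proof (intro equalityI subsetI)
  fix x assume x: "x \<in> ?L"
  then obtain c i where ci: "x = (c, int i)" "1 \<le> i" "i \<le> n"
    by (auto elim: cellE)
  with x have "c = 1 \<or> j < i \<and> c = g i + 1"
    by (auto simp: mem_cells)
  with ci show "x \<in> ?R"
    by auto
next
  fix x assume "x \<in> ?R"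
  then show "x \<in> ?L"
  proof (elim UnE imageE)
    fix i assume "x = (1, int i)" "i \<in> {1..n}"
    then show ?thesis
      using gate_bounds[of i] row_pos[of i] l_pos by (auto simp: mem_cells)
  next
    fix i assume "x = (g i + 1, int i)" "i \<in> {j<..n}"
    then show ?thesis
      using gate_bounds[of i] l_pos by (auto simp: mem_cells)
  qed
qed

text \<open>Each row has one left and one right end, each gated row one more of each, and each of
  the \<open>m n\<close> columns one bottom and one top.\<close>

lemma half_perimeter_cells: "half_perimeter cells = real_of_int (m n) + real n + real (n - j)"
proof -
  have "card {x \<in> cells. (fst x + 1, snd x) \<notin> cells} = n + (n - j)"
    unfolding right_ends
    by (subst card_Un_disjoint) (use gate_bounds in \<open>force simp: card_image inj_on_def\<close>)+
  moreover have "card {x \<in> cells. (fst x - 1, snd x) \<notin> cells} = n + (n - j)"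
    unfolding left_ends
    by (subst card_Un_disjoint) (use gate_bounds l_pos in \<open>force simp: card_image inj_on_def\<close>)+
  moreover have "card {x \<in> cells. (fst x, snd x + 1) \<notin> cells} = nat (m n)"
    "card {x \<in> cells. (fst x, snd x - 1) \<notin> cells} = nat (m n)"
    using card_column_ends[of cells, OF finite_cells column_convex] by (simp_all add: columns)
  ultimately have "card (boundary_edges cells) = 2 * (n + (n - j)) + 2 * nat (m n)"
    by (simp add: card_boundary_edges[OF finite_cells])
  moreover have "0 \<le> m n"
    using row_pos[of n] j_bounds by simp
  ultimately show ?thesis
    by (simp add: half_perimeter_def)
qed

end

text \<open>Column 1 shows \<open>n\<close>, the last cell of each row shows \<open>m\<close>, and
  the rows with a hole show \<open>j\<close>; the two ends of the holes show \<open>l\<close> and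
  \<open>g\<close>.\<close>

lemma gated_ferrers_cells_inject:
  assumes "gated_ferrers_data n j l m g" "gated_ferrers_data n' j' l' m' g'"
    and eq: "gated_ferrers_cells n j l m g = gated_ferrers_cells n' j' l' m' g'"
  shows "n = n'" "j = j'" "l = l'"
    and "\<And>i. 1 \<le> i \<Longrightarrow> i \<le> n \<Longrightarrow> m i = m' i"
    and "\<And>i. j < i \<Longrightarrow> i \<le> n \<Longrightarrow> g i = g' i"
proof -
  interpret a: gated_diagram n j l m g
    by unfold_locales fact
  interpret b: gated_diagram n' j' l' m' g'
    by unfold_locales fact
  have mem: "1 \<le> i \<and> i \<le> n \<and> 1 \<le> c \<and> c \<le> m i \<and> (j < i \<longrightarrow> c \<le> l \<or> g i < c) \<longleftrightarrow>
      1 \<le> i \<and> i \<le> n' \<and> 1 \<le> c \<and> c \<le> m' i \<and> (j' < i \<longrightarrow> c \<le> l' \<or> g' i < c)" for c i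
    using eq a.mem_cells b.mem_cells by metis
  have "i \<le> n \<longleftrightarrow> i \<le> n'" if "1 \<le> i" for i
    using mem[of i 1] a.row_pos[OF that] b.row_pos[OF that] a.l_pos b.l_pos that by auto
  then show n: "n = n'"
    using a.j_bounds b.j_bounds by (meson dual_order.antisym le_refl le_trans less_imp_le)
  show m: "m i = m' i" if i: "1 \<le> i" "i \<le> n" for i
  proof (rule antisym)
    show "m i \<le> m' i"
      using mem[of i "m i"] a.row_pos[OF i] a.gate_bounds[of i] i by auto
    show "m' i \<le> m i"
      using mem[of i "m' i"] b.row_pos[of i] b.gate_bounds[of i] i n by auto
  qed
  \<comment> \<open>Cell \<open>l + 1\<close> of a gated row is absent although
    \<open>l + 1 < m i\<close>, so the other description must have a gate there too.\<close>
  have gap_a: "j' < i" if "j < i" "i \<le> n" for i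
    using mem[of i "l + 1"] a.gate_bounds[OF that] a.l_pos m[of i] that n by auto
  have gap_b: "j < i" if "j' < i" "i \<le> n" for i
    using mem[of i "l' + 1"] b.gate_bounds[of i] b.l_pos m[of i] that n by auto
  show j: "j = j'"
    using gap_a[of "Suc j"] gap_b[of "Suc j'"] a.j_bounds b.j_bounds n by auto
  show "l = l'"
    using mem[of n "l + 1"] mem[of n "l' + 1"] mem[of n l] mem[of n l']
      a.gate_bounds[of n] b.gate_bounds[of n] a.l_pos b.l_pos a.j_bounds j n m[of n] by auto
  show "g i = g' i" if i: "j < i" "i \<le> n" for i
    using mem[of i "g i"] mem[of i "g' i"] a.gate_bounds[OF i] b.gate_bounds[of i]
      a.l_pos b.l_pos a.j_bounds j n m[of i] i by auto
qed

subsection \<open>Diagrams and codes\<close>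

lemma sum_list_take_mono:
  fixes xs :: "nat list"
  assumes "k \<le> k'"
  shows "sum_list (take k xs) \<le> sum_list (take k' xs)"
proof -
  have "take k' xs = take k xs @ take (k' - k) (drop k xs)"
    using assms take_add[of k "k' - k" xs] by simp
  then show ?thesis
    by simp
qed

lemma list_eq_of_partial_sums:
  fixes xs ys :: "nat list"
  assumes len: "length xs = length ys"
    and sums: "\<And>k. k \<le> length xs \<Longrightarrow> sum_list (take k xs) = sum_list (take k ys)"
  shows "xs = ys"
proof (rule nth_equalityI[OF len])
  fix k assume "k < length xs"
  then show "xs ! k = ys ! k"
    using sums[of k] sums[of "Suc k"] len by (simp add: take_Suc_conv_app_nth)
qed

text \<open>The sum telescopes; monotonicity makes the conversion by \<open>nat\<close>
  exact.\<close>

lemma partial_sums_of_differences: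
  fixes f :: "nat \<Rightarrow> int"
  assumes "\<And>k. k < N \<Longrightarrow> f k \<le> f (Suc k)" and "k \<le> N"
  shows "int (sum_list (take k (map (\<lambda>k. nat (f (Suc k) - f k)) [0..<N]))) = f k - f 0"
  using assms(2)
proof (induction k)
  case (Suc k)
  then show ?case
    using assms(1)[of k] by (simp add: take_Suc_conv_app_nth)
qed simp

text \<open>The recursion on the width unfolds into the inequalities \<open>g (i + 1) < m i\<close>;
  with the increments of \<open>g\<close> moved to the left, no truncated subtraction
  remains.\<close>

lemma admissible_iff:
  "admissible d ps \<longleftrightarrow>
     (\<forall>k<length ps. sum_list (take (Suc k) (map fst ps)) < d + sum_list (take k (map snd ps)))"
proof (induction ps arbitrary: d)
  case (Cons s ps)
  show ?case
  proof (cases "fst s < d")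
    case True
    then have "sum_list (take (Suc k) (map fst ps)) <
          d - fst s + snd s + sum_list (take k (map snd ps)) \<longleftrightarrow>
        sum_list (take (Suc (Suc k)) (map fst (s # ps))) <
          d + sum_list (take (Suc k) (map snd (s # ps)))" for k
      by auto
    with True show ?thesis
      by (simp add: Cons.IH All_less_Suc2 del: take_Suc_Cons) simp
  next
    case False
    then show ?thesis
      by auto
  qed
qed simp

text \<open>
  By truncated subtraction, the first sum vanishes for \<open>i\<close> at least \<open>j\<close> and the second one for
  \<open>i\<close> at most \<open>j\<close>.
\<close>

fun code_row :: "nat \<times> nat \<times> nat list \<times> (nat \<times> nat) list \<Rightarrow> nat \<Rightarrow> int" where
  "code_row (d, e, us, ps) i = int e + 2 + int d
     - int (sum_list (take (Suc (length us) - i) us))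
     + int (sum_list (take (i - Suc (length us)) (map snd ps)))"

text \<open>At \<open>i = j\<close> the sum is empty and the value is the fictitious gate
  \<open>l + 1\<close>, so \<open>l < g i\<close> holds automatically.\<close>

fun code_gate :: "nat \<times> nat \<times> nat list \<times> (nat \<times> nat) list \<Rightarrow> nat \<Rightarrow> int" where
  "code_gate (d, e, us, ps) i = int e + 2 + int (sum_list (take (i - Suc (length us)) (map fst ps)))"

fun code_cells :: "nat \<times> nat \<times> nat list \<times> (nat \<times> nat) list \<Rightarrow> cell set" where
  "code_cells (d, e, us, ps) =
     gated_ferrers_cells (Suc (length us) + length ps) (Suc (length us)) (int e + 1)
       (code_row (d, e, us, ps)) (code_gate (d, e, us, ps))"

lemma mem_codes:
  "(d, e, us, ps) \<in> codes \<longleftrightarrow> sum_list us \<le> d + 1 + e \<and> admissible d ps \<and> ps \<noteq> []"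
  by (simp add: codes_def tail_sum_def lower_steps_def upper_steps1_def)

lemma code_data:
  assumes "(d, e, us, ps) \<in> codes"
  shows "gated_ferrers_data (Suc (length us) + length ps) (Suc (length us)) (int e + 1)
    (code_row (d, e, us, ps)) (code_gate (d, e, us, ps))"
proof -
  let ?j = "Suc (length us)" and ?m = "code_row (d, e, us, ps)" and ?g = "code_gate (d, e, us, ps)"
  let ?n = "?j + length ps"
  have us: "sum_list us \<le> d + 1 + e" and ps: "ps \<noteq> []" and adm: "admissible d ps"
    using assms by (auto simp: mem_codes)
  have less: "sum_list (take (Suc k) (map fst ps)) < d + sum_list (take k (map snd ps))"
    if "k < length ps" for k
    using adm that by (simp add: admissible_iff)
  have mono: "?m i \<le> ?m (i + 1)" for i
  proof -
    have "sum_list (take (?j - (i + 1)) us) \<le> sum_list (take (?j - i) us)"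
      by (rule sum_list_take_mono) simp
    moreover have
      "sum_list (take (i - ?j) (map snd ps)) \<le> sum_list (take (i + 1 - ?j) (map snd ps))"
      by (rule sum_list_take_mono) simp
    ultimately show ?thesis
      unfolding code_row.simps by linarith
  qed
  \<comment> \<open>The bound on \<open>us\<close> is \<open>m j - 1\<close>, which leaves at least
    one cell in row 1.\<close>
  have first: "1 \<le> ?m 1"
    using us by simp
  \<comment> \<open>Row \<open>j + k\<close> corresponds to the admissibility inequality for step
    \<open>k\<close>; the case \<open>k = 0\<close> is the condition on \<open>m j\<close>.\<close>
  have below: "?g (i + 1) < ?m i" if i: "?j \<le> i" "i < ?n" for i
  proof -
    obtain k where k: "i = ?j + k" "k < length ps"
      using i by (intro that[of "i - ?j"]) auto
    show ?thesis
      using less[OF k(2)] by (simp add: k(1))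
  qed
  have gate: "?g i < ?m i" if i: "?j < i" "i \<le> ?n" for i
  proof -
    from i obtain i' where "i = i' + 1" "?j \<le> i'" "i' < ?n"
      by (cases i) auto
    then show ?thesis
      using below[of i'] mono[of i'] by simp
  qed
  have gate_mono: "?g i \<le> ?g (i + 1)" for i
    unfolding code_gate.simps
    by (intro add_left_mono) (simp only: of_nat_le_iff, rule sum_list_take_mono, simp)
  have left: "int e + 1 < ?g i" for i
    by simp
  have "?j < ?n"
    using ps by simp
  then show ?thesis
    unfolding gated_ferrers_data_def
    using first mono gate left below gate_mono by (auto simp del: code_row.simps code_gate.simps)
qed

lemma half_perimeter_code_cells:
  assumes "x \<in> codes"
  shows "half_perimeter (code_cells x) = real (3 + code_weight x)"
proof -
  obtain d e us ps where x: "x = (d, e, us, ps)"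
    by (cases x)
  interpret gated_diagram "Suc (length us) + length ps" "Suc (length us)" "int e + 1"
      "code_row (d, e, us, ps)" "code_gate (d, e, us, ps)"
    by unfold_locales (use assms x code_data in auto)
  show ?thesis
    using half_perimeter_cells
    by (simp add: x code_weight_def tail_weight_def upper_weight_def)
qed

text \<open>The cells determine all parameters: \<open>l\<close>, \<open>j\<close>, \<open>n\<close>
  and \<open>m j\<close> yield \<open>e\<close>, the list lengths and \<open>d\<close>, and the
  remaining values are the partial sums of the lists.\<close>

lemma inj_on_code_cells: "inj_on code_cells codes"
proof (rule inj_onI)
  fix x x' assume mem: "x \<in> codes" "x' \<in> codes" and eq: "code_cells x = code_cells x'"
  obtain d e us ps where x: "x = (d, e, us, ps)"
    by (cases x)
  obtain d' e' us' ps' where x': "x' = (d', e', us', ps')"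
    by (cases x')
  note inject = gated_ferrers_cells_inject[OF code_data[OF mem(1)[unfolded x]]
      code_data[OF mem(2)[unfolded x']] eq[unfolded x x' code_cells.simps]]
  have lens: "length us = length us'" "length ps = length ps'" and e: "e = e'"
    using inject(1-3) by auto
  have row: "code_row x i = code_row x' i" if "1 \<le> i" "i \<le> Suc (length us) + length ps" for i
    using inject(4)[OF that] by (simp only: x x')
  have gate: "code_gate x i = code_gate x' i"
    if "Suc (length us) < i" "i \<le> Suc (length us) + length ps" for i
    using inject(5)[OF that] by (simp only: x x')
  have d: "d = d'"
    using row[of "Suc (length us)"] by (simp add: x x' lens e)
  have us: "us = us'"
  proof (rule list_eq_of_partial_sums)
    fix k assume "k \<le> length us"
    then show "sum_list (take k us) = sum_list (take k us')"
      using row[of "Suc (length us) - k"] by (simp add: x x' lens e d Suc_diff_le)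
  qed fact
  have snds: "map snd ps = map snd ps'"
  proof (rule list_eq_of_partial_sums)
    fix k assume "k \<le> length (map snd ps)"
    then show "sum_list (take k (map snd ps)) = sum_list (take k (map snd ps'))"
      using row[of "Suc (length us) + k"] by (simp add: x x' lens e d)
  qed (simp add: lens)
  have fsts: "map fst ps = map fst ps'"
  proof (rule list_eq_of_partial_sums)
    fix k assume k: "k \<le> length (map fst ps)"
    show "sum_list (take k (map fst ps)) = sum_list (take k (map fst ps'))"
    \<comment> \<open>The cells carry no gate value for row \<open>j\<close>, so the empty partial
      sum is treated apart.\<close>
    proof (cases "k = 0")
      case False
      with k show ?thesis
        using gate[of "Suc (length us) + k"] by (simp add: x x' lens e)
    qed simp
  qed (simp add: lens)
  have "ps = ps'"
    using fsts snds by (metis zip_map_fst_snd)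
  then show "x = x'"
    by (simp add: x x' d e us)
qed

lemma gated_ferrers_cells_cong:
  assumes "j \<le> n" "\<And>i. 1 \<le> i \<Longrightarrow> i \<le> n \<Longrightarrow> m i = m' i" "\<And>i. j < i \<Longrightarrow> i \<le> n \<Longrightarrow> g i = g' i"
  shows "gated_ferrers_cells n j l m g = gated_ferrers_cells n j l m' g'"
  using assms unfolding gated_ferrers_cells_def
  by (intro arg_cong2[of _ _ _ _ "(\<union>)"] Collect_cong ex_cong1) auto

lemma (in gated_diagram) cells_in_code_cells: "cells \<in> code_cells ` codes"
proof -
  \<comment> \<open>The gate values above row \<open>j\<close>, extended by the fictitious
    \<open>l + 1\<close> at 0.\<close>
  define gg where "gg = (\<lambda>k. if k = 0 then l + 1 else g (j + k))"
  define d where "d = nat (m j - l - 1)"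
  define e where "e = nat (l - 1)"
  \<comment> \<open>Row lengths decrease on the way down from row \<open>j\<close>; the sign change
    makes the sequence increasing, as telescoping requires.\<close>
  define us where "us = map (\<lambda>k. nat (- m (j - Suc k) - - m (j - k))) [0..<j - 1]"
  define vs where "vs = map (\<lambda>k. nat (m (j + Suc k) - m (j + k))) [0..<n - j]"
  define ws where "ws = map (\<lambda>k. nat (gg (Suc k) - gg k)) [0..<n - j]"
  define ps where "ps = zip ws vs"
  have len: "length us = j - 1" "length vs = n - j" "length ws = n - j" "length ps = n - j"
    by (simp_all add: us_def vs_def ws_def ps_def)
  have ps: "map fst ps = ws" "map snd ps = vs"
    by (simp_all add: ps_def len)
  have e: "int e = l - 1"
    using l_pos by (simp add: e_def)
  \<comment> \<open>From \<open>l < g (j + 1) < m j\<close>; hence \<open>d\<close> is an exact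
    difference, not a truncated one.\<close>
  have mj: "l + 2 \<le> m j"
    using gate_less_below[of j] gate_bounds(1)[of "Suc j"] j_bounds by simp
  then have d: "int d = m j - l - 1"
    by (simp add: d_def)
  have sum_us: "int (sum_list (take k us)) = m j - m (j - k)" if "k \<le> j - 1" for k
  proof -
    have "int (sum_list (take k us)) = - m (j - k) - - m (j - 0)"
      unfolding us_def using that
      by (intro partial_sums_of_differences) (use row_mono j_bounds in auto)
    then show ?thesis
      by simp
  qed
  have sum_vs: "int (sum_list (take k vs)) = m (j + k) - m j" if "k \<le> n - j" for k
  proof -
    have "int (sum_list (take k vs)) = m (j + k) - m (j + 0)"
      unfolding vs_def using that
      by (intro partial_sums_of_differences) (use row_mono j_bounds in auto)
    then show ?thesis
      by simp
  qed
  have gg_mono: "gg k \<le> gg (Suc k)" if "k < n - j" for k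
    using that gate_mono[of "j + k" "j + Suc k"] gate_bounds(1)[of "Suc j"]
    by (auto simp: gg_def)
  have sum_ws: "int (sum_list (take k ws)) = gg k - (l + 1)" if "k \<le> n - j" for k
  proof -
    have "int (sum_list (take k ws)) = gg k - gg 0"
      unfolding ws_def using that gg_mono by (intro partial_sums_of_differences) auto
    then show ?thesis
      by (simp add: gg_def)
  qed
  have j: "Suc (length us) = j"
    using j_bounds len by simp
  have n: "Suc (length us) + length ps = n"
    using j_bounds len by simp
  have row: "code_row (d, e, us, ps) i = m i" if "1 \<le> i" "i \<le> n" for i
  proof (cases "i \<le> j")
    case True
    with that show ?thesis
      using sum_us[of "j - i"] by (simp add: j ps e d)
  next
    case False
    with that show ?thesis
      using sum_vs[of "i - j"] by (simp add: j ps e d)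
  qed
  have gate: "code_gate (d, e, us, ps) i = g i" if "j < i" "i \<le> n" for i
    using that sum_ws[of "i - j"] by (simp add: j ps e gg_def)
  have "sum_list us \<le> d + 1 + e"
  proof -
    have "int (sum_list us) = m j - m 1"
      using sum_us[of "j - 1"] len j_bounds by simp
    then show ?thesis
      using row_pos[of 1] j_bounds d e by simp
  qed
  moreover have "admissible d ps"
    unfolding admissible_iff ps
  proof (intro allI impI)
    fix k assume k: "k < length ps"
    then have "gg (Suc k) < m (j + k)"
      using gate_less_below[of "j + k"] len by (simp add: gg_def)
    then show "sum_list (take (Suc k) ws) < d + sum_list (take k vs)"
      using sum_ws[of "Suc k"] sum_vs[of k] k len d by linarith
  qed
  moreover have "ps \<noteq> []"
    using len j_bounds by auto
  ultimately have "(d, e, us, ps) \<in> codes"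
    by (simp add: mem_codes)
  moreover have "code_cells (d, e, us, ps) = cells"
    unfolding code_cells.simps n unfolding j using row gate j_bounds e
    by (simp add: gated_ferrers_cells_cong[of j n "code_row (d, e, us, ps)" m
          "code_gate (d, e, us, ps)" g] del: code_row.simps code_gate.simps)
  ultimately show ?thesis
    by (metis image_eqI)
qed

lemma gated_ferrers_iff_code: "gated_ferrers S \<longleftrightarrow> S \<in> code_cells ` codes"
proof
  assume "gated_ferrers S"
  then obtain n j l m g where "gated_ferrers_data n j l m g" "S = gated_ferrers_cells n j l m g"
    by (auto simp: gated_ferrers_def)
  then show "S \<in> code_cells ` codes"
    using gated_diagram.cells_in_code_cells[OF gated_diagram.intro] by simp
next
  assume "S \<in> code_cells ` codes"
  then obtain d e us ps where "(d, e, us, ps) \<in> codes" "S = code_cells (d, e, us, ps)"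
    by auto
  then show "gated_ferrers S"
    unfolding gated_ferrers_def using code_data by fastforce
qed

lemma gated_ferrers_gf_eq: "gated_ferrers_gf = fps_X ^ 3 * weight_gf codes code_weight"
proof -
  \<comment> \<open>\<open>half_perimeter\<close> is real-valued, so the natural weight of a code is
    carried over to its set of cells instead.\<close>
  define w where "w = (\<lambda>S. 3 + code_weight (inv_into codes code_cells S))"
  have w: "w (code_cells x) = 3 + code_weight x" if "x \<in> codes" for x
    using that by (simp add: w_def inv_into_f_f[OF inj_on_code_cells])
  have "{S. gated_ferrers S \<and> half_perimeter S = real p} = {S \<in> code_cells ` codes. w S = p}" for p
    using half_perimeter_code_cells w
    by (auto simp: gated_ferrers_iff_code simp del: of_nat_add of_nat_numeral)
  then have "gated_ferrers_gf = weight_gf (code_cells ` codes) w"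
    by (simp add: gated_ferrers_gf_def gated_ferrers_count_def weight_gf_def)
  also have "\<dots> = fps_X ^ 3 * weight_gf codes code_weight"
    using inj_on_code_cells w by (rule weight_gf_image)
  finally show ?thesis .
qed

theorem theorem1:
  fixes t \<phi> :: "int fps"
  defines "t \<equiv> fps_X" and "\<phi> \<equiv> gated_ferrers_gf"
  shows "(t^2 * (1 - 2 * t)^4 * (1 - 3 * t + t^2)) * \<phi>^2
         + (t^4 * (1 - 3 * t + t^2) * (1 - 2 * t)^2) * \<phi> - t^10 = 0"
  unfolding t_def \<phi>_def gated_ferrers_gf_eq by (rule codes_quadratic)

end
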